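(* Let $\mu>0$ and let $(x_k,v_k)_{k\ge0}$ be generated by the SMBA algorithm with $x_0\in\mathcal{Y}$, $\beta\in(0,1)$ and $\alpha_k=\frac{2}{\mu(k+1)}$ for all $k\ge0$. Assume: (a) $f(y)\ge f(x)+\langle\nabla f(x),y-x\rangle+\frac{\mu}{2}\|y-x\|^2$ for all $x,y\in\mathcal{Y}$; (b) the functions $h(\cdot,\xi)$, $\xi\in\Omega$, are convex, and for each $\xi\in\Omega$ there is $L_\xi>0$ with $\|\nabla h(x,\xi)-\nabla h(y,\xi)\|\le L_\xi\|x-y\|$ for all $x,y\in\mathcal{Y}$; (c) there is a constant $c>0$ such that $\operatorname{dist}^2(y,\mathcal{X})\le c\cdot\mathbb{E}_\xi[(h(y,\xi))_+^2]$ for all $y\in\mathcal{Y}$; (d) there are constants $\bar B_f,B_f,B_h,M_h>0$ such that $\|\nabla f(\Pi_{\mathcal{X}}(x_k))\|\le\bar B_f$, $\|\nabla f(x_k)\|\le B_f$, $\|\nabla h(v_k,\xi)\|\le B_h$ and $|h(v_k,\xi)|\le M_h$ for all $\xi\in\Omega$ and $k\ge0$. Let $\mathcal{B}_h^2=\max(B_h^2,\ M_h\cdot\max_{\xi\in\Omega}L_\xi)$ and $$\hat C_{\beta,B_f,\mathcal{B}_h}=\frac{2c\,\mathcal{B}_h^2}{\beta(1-\beta)}\bar B_f^2+\left(1+\frac{2\beta(1-\beta)}{c\,\mathcal{B}_h^2}\right)B_f^2 ,$$ and for $k\ge1$ let $\bar S_k=\sum_{t=0}^{k-1}(t+1)^2$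 and $\hat x_k=\frac{1}{\bar S_k}\sum_{t=0}^{k-1}(t+1)^2x_t$. Let $x^*$ be the unique optimal solution of the problem. Then, for all $k\ge1$, $$\mathbb{E}\big[\|\hat x_k-x^*\|^2\big]\le\mathcal{O}\left(\frac{\hat C_{\beta,B_f,\mathcal{B}_h}}{\mu^2(k+1)}+\frac{c\,\mathcal{B}_h^2\,\hat C_{\beta,B_f,\mathcal{B}_h}}{\beta(1-\beta)\mu^2(k+1)^2}\right),$$ $$\mathbb{E}\big[\operatorname{dist}^2(\hat x_k,\mathcal{X})\big]\le\mathcal{O}\left(\frac{c\,\mathcal{B}_h^2\,\hat C_{\beta,B_f,\mathcal{B}_h}}{\beta(1-\beta)\mu^2(k+1)^2}\right),$$ where $\mathcal{O}(\cdot)$ hides an absolute numerical constant.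
   Context: Problem: $f^*=\min f(x)$ over $x\in\mathcal{Y}\subseteq\mathbb{R}^n$ subject to $h(x,\xi)\le 0$ for all $\xi\in\Omega$, where $\mathcal{Y}$ is a nonempty closed convex set, $\Omega$ is an arbitrary index set, $f:\mathbb{R}^n\to\mathbb{R}$ is convex, and each $h(\cdot,\xi):\mathbb{R}^n\to\mathbb{R}$ is continuously differentiable. The feasible set $\mathcal{X}=\{x\in\mathcal{Y}: h(x,\xi)\le0\ \forall\xi\in\Omega\}$ is nonempty, $f^*$ is finite and the optimal set $\mathcal{X}^*=\{x\in\mathcal{X}:f(x)=f^*\}$ is nonempty (hence, by strong convexity, $\mathcal{X}^*=\{x^*\}$). $\nabla f(x)$ denotes a (chosen) element of the subdifferential $\partial f(x)$. $\Omega$ carries a probability distribution $\mathbf{P}$ and $\mathbb{E}_\xi$ is expectation with respect to $\xi\sim\mathbf{P}$; $\mathbb{E}$ is total expectation. $\Pi_{\mathcal{B}}$ is Euclidean projection onto a closed convex set $\mathcal{B}$, $\operatorname{dist}$ is Euclidean distance, $(a)_+=\max(a,0)$. The quantity $\max_{\xi\in\Omega}L_\xi$ is understood to be finite. For $v\in\mathbb{R}^n$ and $\xi\in\Omega$ let $$c_{v,\xi}=v-\frac1{L_\xi}\nabla h(v,\xi),\qquad R_{v,\xi}=\frac{1}{L_\xi^2}\|\nabla h(v,\xi)\|^2-\frac{2h(v,\xi)}{L_\xi},\qquad p_{v,\xi}=\frac{(h(v,\xi))_+\, L_{\xi}}{1-\frac{\sqrt{(R_{v,\xi})_+}}{\|v-c_{v,\xi}\|}},$$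 with the convention $0/0=0$ (and $p_{v,\xi}=0$ whenever $h(v,\xi)\le0$). SMBA algorithm: choose $x_0$ (deterministic), positive stepsizes $(\alpha_k)_{k\ge0}$ and $\beta>0$. For $k\ge0$: sample $\xi_k\sim\mathbf{P}$ (independently of the past); set $v_k=\Pi_{\mathcal{Y}}(x_k-\alpha_k\nabla f(x_k))$; $z_k=v_k-\beta\frac{(h(v_k,\xi_k))_+}{p_{v_k,\xi_k}}\nabla h(v_k,\xi_k)$ (so $z_k=v_k$ if $h(v_k,\xi_k)\le0$, since $0/0=0$); $x_{k+1}=\Pi_{\mathcal{Y}}(z_k)$. *)

theory Defs
  imports "HOL-Probability.Probability"
begin

definition subdifferential :: "('a::real_inner \<Rightarrow> real) \<Rightarrow> 'a \<Rightarrow> 'a set" where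
  "subdifferential f x = {g. \<forall>y. f y \<ge> f x + g \<bullet> (y - x)}"

definition feasible_set :: "'a set \<Rightarrow> ('a \<Rightarrow> 'w \<Rightarrow> real) \<Rightarrow> 'w set \<Rightarrow> 'a set" where
  "feasible_set Y h \<Omega> = {x \<in> Y. \<forall>\<xi>\<in>\<Omega>. h x \<xi> \<le> 0}"

text \<open>
  In the next four definitions \<open>gh x \<xi>\<close> stands for the gradient of \<open>h(\<cdot>, \<xi>)\<close> at \<open>x\<close>
  and \<open>L \<xi>\<close> for a Lipschitz constant of that gradient.
\<close>

definition smba_center :: "('a::real_inner \<Rightarrow> 'w \<Rightarrow> 'a) \<Rightarrow> ('w \<Rightarrow> real) \<Rightarrow> 'a \<Rightarrow> 'w \<Rightarrow> 'a" where
  "smba_center gh L v \<xi> = v - (1 / L \<xi>) *\<^sub>R gh v \<xi>"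

definition smba_R ::
  "('a::real_inner \<Rightarrow> 'w \<Rightarrow> real) \<Rightarrow> ('a \<Rightarrow> 'w \<Rightarrow> 'a) \<Rightarrow> ('w \<Rightarrow> real) \<Rightarrow> 'a \<Rightarrow> 'w \<Rightarrow> real" where
  "smba_R h gh L v \<xi> = 1 / (L \<xi>)\<^sup>2 * (norm (gh v \<xi>))\<^sup>2 - 2 * h v \<xi> / L \<xi>"

text \<open>
  The convention \<open>0/0 = 0\<close> is the one of HOL division. If \<open>h v \<xi> > 0\<close> and the gradient vanishes,
  then \<open>smba_R\<close> is negative and the inner quotient is \<open>0/0\<close>; if \<open>h v \<xi> > 0\<close> and the gradient does
  not vanish, the inner quotient is less than 1. If \<open>h v \<xi> \<le> 0\<close>, the outer numerator is 0, so that
  \<open>smba_p\<close> is 0 whatever its denominator is.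
\<close>

definition smba_p ::
  "('a::real_inner \<Rightarrow> 'w \<Rightarrow> real) \<Rightarrow> ('a \<Rightarrow> 'w \<Rightarrow> 'a) \<Rightarrow> ('w \<Rightarrow> real) \<Rightarrow> 'a \<Rightarrow> 'w \<Rightarrow> real" where
  "smba_p h gh L v \<xi> =
     max (h v \<xi>) 0 * L \<xi> /
       (1 - sqrt (max (smba_R h gh L v \<xi>) 0) / norm (v - smba_center gh L v \<xi>))"

definition smba_z ::
  "('a::real_inner \<Rightarrow> 'w \<Rightarrow> real) \<Rightarrow> ('a \<Rightarrow> 'w \<Rightarrow> 'a) \<Rightarrow> ('w \<Rightarrow> real) \<Rightarrow> real \<Rightarrow> 'a \<Rightarrow> 'w \<Rightarrow> 'a" where
  "smba_z h gh L \<beta> v \<xi> = v - (\<beta> * (max (h v \<xi>) 0 / smba_p h gh L v \<xi>)) *\<^sub>R gh v \<xi>"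

text \<open>The sigma-algebra on the space of \<open>M\<close> generated by the samples \<open>\<xi> 0, \<dots>, \<xi> (k - 1)\<close>.\<close>

definition sample_history ::
  "'m measure \<Rightarrow> 'w measure \<Rightarrow> (nat \<Rightarrow> 'm \<Rightarrow> 'w) \<Rightarrow> nat \<Rightarrow> 'm measure" where
  "sample_history M P \<xi> k =
     vimage_algebra (space M) (\<lambda>\<omega>. \<lambda>i\<in>{..<k}. \<xi> i \<omega>) (\<Pi>\<^sub>M i\<in>{..<k}. P)"

text \<open>
  \<open>calB_sq\<close> is the squared constant itself. The maximum of the Lipschitz constants is rendered as a
  supremum, so that it need not be attained.
\<close>

definition calB_sq :: "'w set \<Rightarrow> ('w \<Rightarrow> real) \<Rightarrow> real \<Rightarrow> real \<Rightarrow> real" where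
  "calB_sq \<Omega> L B\<^sub>h M\<^sub>h = max (B\<^sub>h\<^sup>2) (M\<^sub>h * (SUP \<xi>\<in>\<Omega>. L \<xi>))"

definition C_hat :: "real \<Rightarrow> real \<Rightarrow> real \<Rightarrow> real \<Rightarrow> real \<Rightarrow> real" where
  "C_hat c Bsq \<beta> Bbar\<^sub>f B\<^sub>f =
     2 * c * Bsq / (\<beta> * (1 - \<beta>)) * Bbar\<^sub>f\<^sup>2
       + (1 + 2 * \<beta> * (1 - \<beta>) / (c * Bsq)) * B\<^sub>f\<^sup>2"

definition S_bar :: "nat \<Rightarrow> real" where
  "S_bar k = (\<Sum>t<k. (real t + 1)\<^sup>2)"

definition x_hat :: "(nat \<Rightarrow> 'm \<Rightarrow> 'a::real_vector) \<Rightarrow> nat \<Rightarrow> 'm \<Rightarrow> 'a" where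
  "x_hat x k \<omega> = (1 / S_bar k) *\<^sub>R (\<Sum>t<k. (real t + 1)\<^sup>2 *\<^sub>R x t \<omega>)"

end

theory Submission
  imports Defs
begin

text \<open>
  A squared distance to the solution that shrinks by the factor \<open>1 - \<alpha>\<^sub>k \<mu>\<close> up to an error of order
  \<open>\<alpha>\<^sub>k\<^sup>2\<close> decays like \<open>1 / k\<close> for \<open>\<alpha>\<^sub>k = 2 / (\<mu> (k + 1))\<close>. The proof establishes such a recursion in
  expectation, together with an extra gain that controls the distance to the feasible set.
  
  The feasibility step from \<open>v\<^sub>k\<close> to \<open>x\<^sub>k\<^sub>+\<^sub>1\<close> decreases the squared distance to every feasible point by at
  least \<open>2 \<beta> (1 - \<beta>) / \<B>\<^sub>h\<^sup>2\<close> times the squared sampled violation (\<open>smba_z_decrease\<close>). This rests on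
  two bounds for the step length, \<open>smba_step_length\<close>, and on the fact that a convex function lies above
  its tangents. The sample \<open>\<xi>\<^sub>k\<close> is independent of \<open>v\<^sub>k\<close>, so by the regularity assumption the expected
  decrease is at least \<open>q = 2 \<beta> (1 - \<beta>) / (c \<B>\<^sub>h\<^sup>2)\<close> times the expectation of \<open>dist\<^sup>2(v\<^sub>k, X)\<close>; the
  measure-theoretic part is \<open>nn_integral_past_and_next_sample\<close>.
  
  The optimality step from \<open>x\<^sub>k\<close> to \<open>v\<^sub>k\<close> is a projected subgradient step; strong convexity supplies the
  factor \<open>1 - \<alpha>\<^sub>k \<mu>\<close> (\<open>projected_subgradient_step\<close>). As \<open>x\<^sub>k\<close> need not be feasible, its objective value may
  lie below the optimum, but by no more than the distance to \<open>X\<close> times the bound on the subgradient at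
  the projection (\<open>optimality_gap_le_infdist\<close>). Since \<open>v\<^sub>k\<close> is within \<open>\<alpha>\<^sub>k B\<^sub>f\<close> of \<open>x\<^sub>k\<close>, half of the gain from
  the feasibility step becomes a gain in \<open>dist\<^sup>2(x\<^sub>k, X)\<close>, and half of that in turn pays for the
  negative gap (\<open>combined_step_decrease\<close>). In expectation,
  \<open>a\<^sub>k\<^sub>+\<^sub>1 + q / 4 * D\<^sub>k \<le> (1 - \<alpha>\<^sub>k \<mu>) a\<^sub>k + \<alpha>\<^sub>k\<^sup>2 C\<close>
  with \<open>a\<^sub>k\<close> the mean squared distance of \<open>x\<^sub>k\<close> to the solution, \<open>D\<^sub>k\<close> that to \<open>X\<close>, and the constant \<open>C\<close> of
  the theorem.
  
  With weights \<open>(k + 1)\<^sup>2\<close> this telescopes (\<open>weighted_recursion_bounds\<close>) and bounds the weighted averages of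
  \<open>a\<close> and \<open>D\<close>; convexity of the squared norm and of the squared distance to \<open>X\<close> carries these bounds over
  to the averaged iterate.
\<close>

section \<open>Convexity and projections\<close>

text \<open>
  Restricting \<open>f\<close> to the line through \<open>x\<close> and \<open>y\<close> reduces the claim to the tangent inequality for
  convex functions of one real variable.
\<close>
lemma convex_above_gradient_tangent:
  fixes f :: "'a::real_inner \<Rightarrow> real"
  assumes "convex_on UNIV f" and "GDERIV f x :> g"
  shows "f x + g \<bullet> (y - x) \<le> f y"
proof -
  define line where "line t = x + t *\<^sub>R (y - x)" for t :: real
  have line: "line 0 = x" "line 1 = y"
    by (simp_all add: line_def)
  have "convex_on UNIV (f \<circ> line)"
  proof (rule convex_onI)
    fix t a b :: real assume "0 < t" "t < 1"
    moreover have "line ((1 - t) *\<^sub>R a + t *\<^sub>R b) = (1 - t) *\<^sub>R line a + t *\<^sub>R line b"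
      by (simp add: line_def algebra_simps)
    ultimately show "(f \<circ> line) ((1 - t) *\<^sub>R a + t *\<^sub>R b) \<le> (1 - t) * (f \<circ> line) a + t * (f \<circ> line) b"
      using convex_onD[OF assms(1), of t "line a" "line b"] by simp
  qed simp
  moreover have "(f \<circ> line has_real_derivative g \<bullet> (y - x)) (at 0)"
  proof -
    have "(line has_derivative (\<lambda>t. t *\<^sub>R (y - x))) (at 0)"
      unfolding line_def by (auto intro!: derivative_eq_intros)
    moreover have "(f has_derivative (\<lambda>u. u \<bullet> g)) (at (line 0))"
      using assms(2) by (simp add: gderiv_def line)
    ultimately have "(f \<circ> line has_derivative (\<lambda>u. u \<bullet> g) \<circ> (\<lambda>t. t *\<^sub>R (y - x))) (at 0)"
      by (rule diff_chain_at)
    moreover have "(\<lambda>u. u \<bullet> g) \<circ> (\<lambda>t. t *\<^sub>R (y - x)) = (*) (g \<bullet> (y - x))"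
      by (simp add: fun_eq_iff inner_commute)
    ultimately show ?thesis
      by (simp add: has_field_derivative_def)
  qed
  ultimately show ?thesis
    using convex_on_imp_above_tangent[of UNIV "f \<circ> line" 0 1 "g \<bullet> (y - x)"] by (simp add: line)
qed

text \<open>
  Jensen's inequality for the squared norm; it passes from bounds on the iterates to bounds on
  their weighted average.
\<close>
lemma norm_average_sq_le:
  fixes z :: "'i \<Rightarrow> 'a::real_inner"
  assumes I: "finite I" and w: "\<And>i. i \<in> I \<Longrightarrow> 0 \<le> w i" and W: "(\<Sum>i\<in>I. w i) = W" "W > 0"
  shows "(norm ((1 / W) *\<^sub>R (\<Sum>i\<in>I. w i *\<^sub>R z i)))\<^sup>2 \<le> 1 / W * (\<Sum>i\<in>I. w i * (norm (z i))\<^sup>2)"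
proof -
  define u where "u i = w i / W" for i
  have ne: "I \<noteq> {}" using W by auto
  have u: "(\<Sum>i\<in>I. u i) = 1" "\<And>i. i \<in> I \<Longrightarrow> 0 \<le> u i"
    using w W by (auto simp: u_def sum_divide_distrib[symmetric])
  have "(1 / W) *\<^sub>R (\<Sum>i\<in>I. w i *\<^sub>R z i) = (\<Sum>i\<in>I. u i *\<^sub>R z i)"
    by (simp add: u_def scaleR_sum_right)
  moreover have "norm (\<Sum>i\<in>I. u i *\<^sub>R z i) \<le> (\<Sum>i\<in>I. u i * norm (z i))"
    using u(2) by (intro order_trans[OF norm_sum] sum_mono) simp
  ultimately have "(norm ((1 / W) *\<^sub>R (\<Sum>i\<in>I. w i *\<^sub>R z i)))\<^sup>2 \<le> (\<Sum>i\<in>I. u i *\<^sub>R norm (z i))\<^sup>2"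
    by (simp add: power_mono)
  also have "\<dots> \<le> (\<Sum>i\<in>I. u i * (norm (z i))\<^sup>2)"
    using u by (intro convex_on_sum[OF I ne convex_power2]) auto
  also have "\<dots> = 1 / W * (\<Sum>i\<in>I. w i * (norm (z i))\<^sup>2)"
    by (simp add: u_def sum_distrib_left)
  finally show ?thesis .
qed

lemma infdist_closest_point:
  fixes S :: "'a::euclidean_space set"
  assumes "closed S" "S \<noteq> {}"
  shows "infdist y S = norm (y - closest_point S y)"
  by (simp add: infdist_eq_setdist setdist_closest_point[OF assms] dist_norm)

lemma norm_closest_point_diff_le:
  fixes S :: "'a::euclidean_space set"
  assumes "convex S" "closed S" "y \<in> S"
  shows "norm (closest_point S u - y) \<le> norm (u - y)"
proof -
  have "S \<noteq> {}" using assms(3) by auto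
  then show ?thesis
    using closest_point_lipschitz[OF assms(1,2), of u y] closest_point_self[OF assms(3)]
    by (simp add: dist_norm)
qed

text \<open>
  The squared distance to a convex set is convex: the average of the projections lies in the set
  and is therefore a competitor for the projection of the average.
\<close>
lemma infdist_average_sq_le:
  fixes S :: "'a::euclidean_space set"
  assumes S: "convex S" "closed S" "S \<noteq> {}"
    and I: "finite I" and w: "\<And>i. i \<in> I \<Longrightarrow> 0 \<le> w i" and W: "(\<Sum>i\<in>I. w i) = W" "W > 0"
  shows "(infdist ((1 / W) *\<^sub>R (\<Sum>i\<in>I. w i *\<^sub>R z i)) S)\<^sup>2
    \<le> 1 / W * (\<Sum>i\<in>I. w i * (infdist (z i) S)\<^sup>2)"
proof -
  define p where "p i = closest_point S (z i)" for i
  define avg where "avg u = (1 / W) *\<^sub>R (\<Sum>i\<in>I. w i *\<^sub>R u i)" for u :: "'b \<Rightarrow> 'a"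
  have "(\<Sum>i\<in>I. (w i / W) *\<^sub>R p i) \<in> S"
    using closest_point_in_set[OF S(2,3)] w W
    by (intro convex_sum[OF I S(1)]) (auto simp: p_def sum_divide_distrib[symmetric])
  then have "avg p \<in> S"
    by (simp add: avg_def scaleR_sum_right)
  then have "infdist (avg z) S \<le> norm (avg z - avg p)"
    using infdist_le by (fastforce simp: dist_norm)
  also have "avg z - avg p = avg (\<lambda>i. z i - p i)"
    by (simp add: avg_def scaleR_diff_right sum_subtractf)
  finally have "(infdist (avg z) S)\<^sup>2 \<le> (norm (avg (\<lambda>i. z i - p i)))\<^sup>2"
    by (intro power_mono infdist_nonneg)
  also have "\<dots> \<le> 1 / W * (\<Sum>i\<in>I. w i * (norm (z i - p i))\<^sup>2)"
    unfolding avg_def by (rule norm_average_sq_le[OF I w W])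
  finally show ?thesis
    by (simp add: avg_def p_def infdist_closest_point[OF S(2,3)])
qed

lemma feasible_set_closed_convex:
  fixes h :: "'a::real_inner \<Rightarrow> 'w \<Rightarrow> real"
  assumes "closed Y" "convex Y"
    and conv: "\<And>\<zeta>. \<zeta> \<in> \<Omega> \<Longrightarrow> convex_on UNIV (\<lambda>u. h u \<zeta>)"
    and cont: "\<And>\<zeta>. \<zeta> \<in> \<Omega> \<Longrightarrow> continuous_on UNIV (\<lambda>u. h u \<zeta>)"
  shows "closed (feasible_set Y h \<Omega>)" and "convex (feasible_set Y h \<Omega>)"
proof -
  have eq: "feasible_set Y h \<Omega> = Y \<inter> (\<Inter>\<zeta>\<in>\<Omega>. {u. h u \<zeta> \<le> 0})"
    by (auto simp: feasible_set_def)
  have "convex {u. h u \<zeta> \<le> 0}" if "\<zeta> \<in> \<Omega>" for \<zeta>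
  proof (rule convexI)
    fix u w and a b :: real
    assume uw: "u \<in> {u. h u \<zeta> \<le> 0}" "w \<in> {u. h u \<zeta> \<le> 0}" and ab: "0 \<le> a" "0 \<le> b" "a + b = 1"
    have "h (a *\<^sub>R u + b *\<^sub>R w) \<zeta> \<le> a * h u \<zeta> + b * h w \<zeta>"
      using conv[OF that] ab by (simp add: convex_on_def)
    also have "\<dots> \<le> 0"
      using uw ab by (intro add_nonpos_nonpos mult_nonneg_nonpos) auto
    finally show "a *\<^sub>R u + b *\<^sub>R w \<in> {u. h u \<zeta> \<le> 0}" by simp
  qed
  then show "convex (feasible_set Y h \<Omega>)"
    unfolding eq using assms(2) by (intro convex_Int convex_INT)
  show "closed (feasible_set Y h \<Omega>)"
    unfolding eq using assms(1) cont
    by (intro closed_Int closed_INT ballI closed_Collect_le continuous_on_const)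
qed

section \<open>The feasibility step\<close>

text \<open>
  All that the analysis needs to know about the step length \<open>s = (h)\<^sub>+ / p\<close> at a violated constraint.
  Write \<open>G = \<parallel>\<nabla>h\<parallel>\<close>. Cancelling \<open>h\<close> gives \<open>s = (1 - r) / L\<close> with \<open>r\<^sup>2 = (1 - 2 h L / G\<^sup>2)\<^sub>+\<close>.
  If \<open>R \<ge> 0\<close>, then \<open>s G\<^sup>2 (1 + r) = 2 h\<close> with \<open>0 \<le> r < 1\<close>, so \<open>s G\<^sup>2\<close> lies between \<open>h\<close> and \<open>2 h\<close>.
  If \<open>R < 0\<close>, then \<open>r = 0\<close>, so \<open>s L = 1\<close>, and \<open>R < 0\<close> itself says \<open>s G\<^sup>2 < 2 h\<close>. The upper bound on \<open>s\<close>
  keeps the step from overshooting; the lower bound makes it long enough to gain a multiple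
  of \<open>h\<^sup>2\<close>, and its two cases are the reason for the maximum in the constant \<open>\<B>\<^sub>h\<^sup>2\<close>.
\<close>
lemma smba_step_length:
  fixes h :: "'a::real_inner \<Rightarrow> 'w \<Rightarrow> real"
  assumes h: "h v \<zeta> > 0" and g: "gh v \<zeta> \<noteq> 0" and L: "L \<zeta> > 0"
  defines "s \<equiv> max (h v \<zeta>) 0 / smba_p h gh L v \<zeta>"
  shows "s \<ge> 0" and "s * (norm (gh v \<zeta>))\<^sup>2 \<le> 2 * h v \<zeta>"
    and "h v \<zeta> \<le> s * max ((norm (gh v \<zeta>))\<^sup>2) (h v \<zeta> * L \<zeta>)"
proof -
  define G where "G = norm (gh v \<zeta>)"
  define r where "r = sqrt (max (smba_R h gh L v \<zeta>) 0) / (G / L \<zeta>)"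
  have G: "G > 0" using g by (simp add: G_def)
  have "norm (v - smba_center gh L v \<zeta>) = G / L \<zeta>"
    using L by (simp add: smba_center_def G_def)
  then have s: "s = (1 - r) / L \<zeta>"
    using h L by (simp add: s_def smba_p_def r_def)
  have r0: "r \<ge> 0"
    using G L by (simp add: r_def)
  have "r\<^sup>2 = max (smba_R h gh L v \<zeta>) 0 / (G / L \<zeta>)\<^sup>2"
    unfolding r_def power_divide by simp
  also have "\<dots> = max (smba_R h gh L v \<zeta> / (G / L \<zeta>)\<^sup>2) 0"
    using G L by (simp add: max_def divide_le_0_iff)
  also have "smba_R h gh L v \<zeta> / (G / L \<zeta>)\<^sup>2 = 1 - 2 * h v \<zeta> * L \<zeta> / G\<^sup>2"
    using G L by (simp add: smba_R_def G_def[symmetric] field_simps power2_eq_square)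
  finally have r2: "r\<^sup>2 = max (1 - 2 * h v \<zeta> * L \<zeta> / G\<^sup>2) 0" .
  have r1: "r < 1"
  proof -
    have "r\<^sup>2 < 1\<^sup>2" using G L h by (simp add: r2)
    then show ?thesis using r0 by (simp add: power2_less_imp_less)
  qed
  show "s \<ge> 0" using r1 L by (simp add: s)
  have Ls: "L \<zeta> * s = 1 - r" using L by (simp add: s)
  have "s * G\<^sup>2 \<le> 2 * h v \<zeta> \<and> h v \<zeta> \<le> s * max (G\<^sup>2) (h v \<zeta> * L \<zeta>)"
  proof (cases "2 * h v \<zeta> * L \<zeta> \<le> G\<^sup>2")
    case True
    then have "r\<^sup>2 = 1 - 2 * h v \<zeta> * L \<zeta> / G\<^sup>2"
      using r2 G by (simp add: max_def field_simps)
    \<comment> \<open>dividing \<open>1 - r\<^sup>2 = 2 h L / G\<^sup>2\<close> by \<open>L\<close>\<close>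
    then have "(1 - r) * (1 + r) * G\<^sup>2 = 2 * h v \<zeta> * L \<zeta>"
      using G by (simp add: field_simps power2_eq_square)
    then have eq: "s * G\<^sup>2 * (1 + r) = 2 * h v \<zeta>"
      using L by (simp add: s field_simps)
    have sG: "s * G\<^sup>2 \<ge> 0" using \<open>s \<ge> 0\<close> by simp
    have "s * G\<^sup>2 * 1 \<le> s * G\<^sup>2 * (1 + r)" "s * G\<^sup>2 * (1 + r) \<le> s * G\<^sup>2 * 2"
      using sG r0 r1 by (intro mult_left_mono; linarith)+
    then have "s * G\<^sup>2 \<le> 2 * h v \<zeta>" "h v \<zeta> \<le> s * G\<^sup>2"
      using eq by auto
    moreover have "s * G\<^sup>2 \<le> s * max (G\<^sup>2) (h v \<zeta> * L \<zeta>)"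
      using \<open>s \<ge> 0\<close> by (intro mult_left_mono) auto
    ultimately show ?thesis by linarith
  next
    case False
    then have "r = 0" using r2 G by (simp add: max_def field_simps split: if_splits)
    then have s1: "s = 1 / L \<zeta>" by (simp add: s)
    have "h v \<zeta> = s * (h v \<zeta> * L \<zeta>)" using L by (simp add: s1)
    also have "\<dots> \<le> s * max (G\<^sup>2) (h v \<zeta> * L \<zeta>)"
      using \<open>s \<ge> 0\<close> by (intro mult_left_mono) auto
    finally show ?thesis
      using False L by (simp add: s1 field_simps)
  qed
  then show "s * (norm (gh v \<zeta>))\<^sup>2 \<le> 2 * h v \<zeta>"
    and "h v \<zeta> \<le> s * max ((norm (gh v \<zeta>))\<^sup>2) (h v \<zeta> * L \<zeta>)"
    by (simp_all add: G_def)
qed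

text \<open>
  Moving towards the half-space \<open>{y. h v + \<nabla>h v \<bullet> (y - v) \<le> 0}\<close>, which contains every feasible point,
  brings the iterate closer to all of them. In the expansion of \<open>\<parallel>v - \<beta> s \<nabla>h - y\<parallel>\<^sup>2\<close> the linear term
  gains \<open>2 \<beta> s h\<close> and the quadratic term loses \<open>\<beta>\<^sup>2 s (s \<parallel>\<nabla>h\<parallel>\<^sup>2) \<le> 2 \<beta>\<^sup>2 s h\<close>, which leaves
  \<open>2 \<beta> (1 - \<beta>) s h\<close>, and \<open>s h \<ge> h\<^sup>2 / B\<close> by the lower bound on the step length.
\<close>
lemma smba_z_decrease:
  fixes h :: "'a::real_inner \<Rightarrow> 'w \<Rightarrow> real"
  assumes cut: "h v \<zeta> + gh v \<zeta> \<bullet> (y - v) \<le> 0" and L: "L \<zeta> > 0" and \<beta>: "0 < \<beta>" "\<beta> < 1"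
    and B: "(norm (gh v \<zeta>))\<^sup>2 \<le> B" "h v \<zeta> * L \<zeta> \<le> B" "B > 0"
  shows "(norm (smba_z h gh L \<beta> v \<zeta> - y))\<^sup>2 + 2 * \<beta> * (1 - \<beta>) / B * (max (h v \<zeta>) 0)\<^sup>2
    \<le> (norm (v - y))\<^sup>2"
proof (cases "h v \<zeta> > 0")
  case False
  then show ?thesis by (simp add: smba_z_def max_def)
next
  case True
  define g where "g = gh v \<zeta>"
  define H where "H = h v \<zeta>"
  define s where "s = max (h v \<zeta>) 0 / smba_p h gh L v \<zeta>"
  have H: "H > 0" using True by (simp add: H_def)
  have "gh v \<zeta> \<noteq> 0" using cut True by auto
  note s = smba_step_length[where h = h and gh = gh and L = L and v = v and \<zeta> = \<zeta>, OF True this L, folded s_def]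
  have gy: "H \<le> g \<bullet> (v - y)"
    using cut by (simp add: g_def H_def inner_diff_right)
  have "H \<le> s * B"
    using s(3) mult_left_mono[OF _ s(1), of "max ((norm (gh v \<zeta>))\<^sup>2) (h v \<zeta> * L \<zeta>)" B] B
    by (simp add: H_def)
  then have "H * H / B \<le> s * H"
    using H B(3) mult_right_mono[of H "s * B" H] by (simp add: field_simps)
  then have gain: "2 * \<beta> * (1 - \<beta>) * (H * H / B) \<le> 2 * \<beta> * (1 - \<beta>) * (s * H)"
    using \<beta> by (intro mult_left_mono) auto
  have "smba_z h gh L \<beta> v \<zeta> - y = (v - y) - (\<beta> * s) *\<^sub>R g"
    by (simp add: smba_z_def s_def g_def)
  also have "(norm \<dots>)\<^sup>2 = (norm (v - y))\<^sup>2 - 2 * (\<beta> * s) * (g \<bullet> (v - y)) + \<beta>\<^sup>2 * s * (s * (norm g)\<^sup>2)"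
    unfolding power2_norm_eq_inner inner_diff_left inner_diff_right inner_scaleR_left inner_scaleR_right
    by (simp add: inner_commute power2_eq_square algebra_simps)
  also have "\<dots> \<le> (norm (v - y))\<^sup>2 - 2 * (\<beta> * s) * H + \<beta>\<^sup>2 * s * (2 * H)"
    using gy s(1,2) \<beta> by (intro add_mono diff_left_mono mult_left_mono) (auto simp: g_def H_def)
  also have "\<dots> = (norm (v - y))\<^sup>2 - 2 * \<beta> * (1 - \<beta>) * (s * H)"
    by (simp add: algebra_simps power2_eq_square)
  finally have "(norm (smba_z h gh L \<beta> v \<zeta> - y))\<^sup>2 + 2 * \<beta> * (1 - \<beta>) * (H * H / B) \<le> (norm (v - y))\<^sup>2"
    using gain by linarith
  then show ?thesis
    using H by (simp add: H_def power2_eq_square)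
qed

section \<open>The optimality step\<close>

lemma projected_subgradient_step:
  fixes f :: "'a::euclidean_space \<Rightarrow> real"
  assumes Y: "convex Y" "closed Y" "y \<in> Y" and \<alpha>: "\<alpha> \<ge> 0"
    and sc: "f y \<ge> f x + g \<bullet> (y - x) + \<mu> / 2 * (norm (y - x))\<^sup>2"
    and g: "norm g \<le> B"
  shows "(norm (closest_point Y (x - \<alpha> *\<^sub>R g) - y))\<^sup>2
    \<le> (1 - \<alpha> * \<mu>) * (norm (x - y))\<^sup>2 + 2 * \<alpha> * (f y - f x) + \<alpha>\<^sup>2 * B\<^sup>2"
proof -
  have "(norm (closest_point Y (x - \<alpha> *\<^sub>R g) - y))\<^sup>2 \<le> (norm ((x - y) - \<alpha> *\<^sub>R g))\<^sup>2"
    using norm_closest_point_diff_le[OF Y, of "x - \<alpha> *\<^sub>R g"] by (simp add: algebra_simps power_mono)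
  also have "\<dots> = (norm (x - y))\<^sup>2 + 2 * \<alpha> * (g \<bullet> (y - x)) + \<alpha>\<^sup>2 * (norm g)\<^sup>2"
    unfolding power2_norm_eq_inner inner_diff_left inner_diff_right inner_scaleR_left inner_scaleR_right
    by (simp add: inner_commute power2_eq_square algebra_simps)
  also have "\<dots> \<le> (norm (x - y))\<^sup>2 + 2 * \<alpha> * (f y - f x - \<mu> / 2 * (norm (x - y))\<^sup>2) + \<alpha>\<^sup>2 * B\<^sup>2"
    using sc \<alpha> g by (intro add_mono mult_left_mono power_mono) (auto simp: norm_minus_commute)
  finally show ?thesis by (simp add: algebra_simps)
qed

text \<open>
  An infeasible iterate may have a smaller objective value than the optimum, but only as far as its
  distance to the feasible set allows: compare it with its projection \<open>p\<close>, where \<open>f p \<ge> f xstar\<close>.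
\<close>
lemma optimality_gap_le_infdist:
  fixes f :: "'a::euclidean_space \<Rightarrow> real"
  assumes X: "closed X" and xstar: "is_arg_min f (\<lambda>y. y \<in> X) xstar"
    and g: "g \<in> subdifferential f (closest_point X x)" "norm g \<le> B"
  shows "f xstar - f x \<le> B * infdist x X"
proof -
  define p where "p = closest_point X x"
  have "xstar \<in> X" using xstar by (simp add: is_arg_min_def)
  then have ne: "X \<noteq> {}" by auto
  have "p \<in> X" unfolding p_def by (rule closest_point_in_set[OF X ne])
  then have "f xstar \<le> f p" using xstar by (auto simp: is_arg_min_def not_less)
  also have "f p - f x \<le> g \<bullet> (p - x)"
    using g(1) by (simp add: subdifferential_def p_def[symmetric] inner_diff_right) (smt (verit))
  also have "g \<bullet> (p - x) \<le> norm g * norm (p - x)" by (rule norm_cauchy_schwarz)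
  also have "\<dots> \<le> B * norm (p - x)" using g(2) by (rule mult_right_mono) simp
  finally show ?thesis
    by (simp add: infdist_closest_point[OF X ne] p_def norm_minus_commute)
qed

text \<open>
  One iteration for a single outcome: \<open>a\<close>, \<open>b\<close>, \<open>a'\<close> are the squared distances of \<open>x\<^sub>k\<close>, \<open>v\<^sub>k\<close>, \<open>x\<^sub>k\<^sub>+\<^sub>1\<close>
  to the solution, \<open>d\<close> and \<open>e\<close> the distances of \<open>x\<^sub>k\<close> and \<open>v\<^sub>k\<close> to the feasible set, and \<open>H\<close> is the sampled
  constraint violation. Young's inequality absorbs the term \<open>2 \<alpha> Bbar d\<close>, coming from a negative
  optimality gap, into \<open>q / 4 * d\<^sup>2\<close>. The term \<open>q e\<^sup>2\<close> is left on the right because it is compensated by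
  \<open>\<rho> H\<^sup>2\<close> only in expectation.
\<close>
lemma combined_step_decrease:
  fixes q \<rho> a a' b d e H \<alpha> Bbar Bf \<mu> gap :: real
  assumes pos: "q > 0" "\<alpha> \<ge> 0"
    and feas: "a' + \<rho> * H\<^sup>2 \<le> b"
    and opt: "b \<le> (1 - \<alpha> * \<mu>) * a + 2 * \<alpha> * gap + \<alpha>\<^sup>2 * Bf\<^sup>2"
    and gap: "gap \<le> Bbar * d"
    and dist: "0 \<le> d" "d \<le> e + \<alpha> * Bf"
  shows "a' + \<rho> * H\<^sup>2 + q / 4 * d\<^sup>2 \<le> (1 - \<alpha> * \<mu>) * a + q * e\<^sup>2 + \<alpha>\<^sup>2 * (4 / q * Bbar\<^sup>2 + (1 + q) * Bf\<^sup>2)"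
proof -
  have "2 * \<alpha> * gap \<le> 2 * \<alpha> * (Bbar * d)"
    using gap pos by (intro mult_left_mono) auto
  also have "\<dots> \<le> q / 4 * d\<^sup>2 + \<alpha>\<^sup>2 * (4 / q * Bbar\<^sup>2)"
  proof -
    \<comment> \<open>Young's inequality in the form of a completed square\<close>
    have "0 \<le> (q / 2 * d - 2 * \<alpha> * Bbar)\<^sup>2 / q" using pos by simp
    then show ?thesis using pos by (simp add: field_simps power2_eq_square)
  qed
  finally have young: "2 * \<alpha> * gap \<le> q / 4 * d\<^sup>2 + \<alpha>\<^sup>2 * (4 / q * Bbar\<^sup>2)" .
  have "d\<^sup>2 \<le> (e + \<alpha> * Bf)\<^sup>2" using dist by (intro power_mono)
  also have "\<dots> \<le> 2 * e\<^sup>2 + 2 * (\<alpha> * Bf)\<^sup>2"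
    using zero_le_power2[of "e - \<alpha> * Bf"] by (simp add: power2_eq_square algebra_simps)
  finally have "q / 2 * d\<^sup>2 \<le> q / 2 * (2 * e\<^sup>2 + 2 * (\<alpha> * Bf)\<^sup>2)"
    using pos by (intro mult_left_mono) auto
  then have "q / 2 * d\<^sup>2 \<le> q * e\<^sup>2 + \<alpha>\<^sup>2 * (q * Bf\<^sup>2)"
    by (simp add: algebra_simps power_mult_distrib)
  then show ?thesis
    using young feas opt by (simp add: algebra_simps)
qed

section \<open>Sampling independently of the past\<close>

text \<open>
  Caratheodory functions are jointly measurable: \<open>h\<close> is the pointwise limit of the functions
  \<open>(y, \<zeta>) \<mapsto> h (d (near n y)) \<zeta>\<close>, where \<open>near n\<close> rounds \<open>y\<close> to a member of a countable dense set.
\<close>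
lemma measurable_pair_continuous_in_fst:
  fixes h :: "'a::{second_countable_topology, metric_space} \<Rightarrow> 'w \<Rightarrow> real"
  assumes cont: "\<And>\<zeta>. \<zeta> \<in> space P \<Longrightarrow> continuous_on UNIV (\<lambda>y. h y \<zeta>)"
    and meas: "\<And>y. h y \<in> borel_measurable P"
  shows "(\<lambda>(y, \<zeta>). h y \<zeta>) \<in> borel_measurable (borel \<Otimes>\<^sub>M P)"
proof -
  obtain D :: "'a set" where D: "countable D" "\<And>S. open S \<Longrightarrow> S \<noteq> {} \<Longrightarrow> \<exists>d\<in>D. d \<in> S"
    by (rule countable_dense_setE) blast
  then have "D \<noteq> {}" using D(2)[of UNIV] by auto
  define d where "d = from_nat_into D"
  have dense: "\<exists>i. dist y (d i) < e" if "e > 0" for y e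
    using D(2)[of "ball y e"] that from_nat_into_surj[OF D(1)] unfolding d_def
    by (metis centre_in_ball emptyE mem_ball open_ball)
  define near where "near n y = (LEAST i. dist y (d i) < 1 / (real n + 1))" for n y
  have near: "dist y (d (near n y)) < 1 / (real n + 1)" for n y
    unfolding near_def by (rule LeastI_ex[OF dense]) simp
  have [measurable]: "near n \<in> measurable borel (count_space UNIV)" for n
    unfolding near_def by measurable
  have near_lim: "(\<lambda>n. d (near n y)) \<longlonglongrightarrow> y" for y
  proof -
    have "(\<lambda>n. dist (d (near n y)) y) \<longlonglongrightarrow> 0"
    proof (rule tendsto_sandwich[OF _ _ tendsto_const])
      show "eventually (\<lambda>n. dist (d (near n y)) y \<le> 1 / (real n + 1)) sequentially"
        using near by (intro always_eventually allI less_imp_le) (simp add: dist_commute)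
      show "(\<lambda>n. 1 / (real n + 1)) \<longlonglongrightarrow> 0"
        using LIMSEQ_inverse_real_of_nat by (simp add: inverse_eq_divide add.commute)
    qed simp
    then show ?thesis by (rule tendsto_dist_iff[THEN iffD2])
  qed
  show ?thesis
  proof (rule borel_measurable_LIMSEQ_real)
    fix n
    have "(\<lambda>z. h (d i) (snd z)) \<in> borel_measurable (borel \<Otimes>\<^sub>M P)" for i
      by (rule measurable_compose[OF measurable_snd meas])
    moreover have "(\<lambda>z. near n (fst z)) \<in> measurable (borel \<Otimes>\<^sub>M P) (count_space UNIV)"
      by measurable
    ultimately show "(\<lambda>z. h (d (near n (fst z))) (snd z)) \<in> borel_measurable (borel \<Otimes>\<^sub>M P)"
      by (rule measurable_compose_countable)
  next
    fix z :: "'a \<times> 'w" assume "z \<in> space (borel \<Otimes>\<^sub>M P)"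
    then have "isCont (\<lambda>y. h y (snd z)) (fst z)"
      using cont[of "snd z"] by (auto simp: space_pair_measure continuous_on_eq_continuous_at)
    from isCont_tendsto_compose[OF this near_lim]
    show "(\<lambda>n. h (d (near n (fst z))) (snd z)) \<longlonglongrightarrow> (case z of (y, \<zeta>) \<Rightarrow> h y \<zeta>)"
      by (simp add: case_prod_beta)
  qed
qed

lemma (in prob_space) measurable_sample_history_imp:
  assumes indep: "indep_vars (\<lambda>_. P) \<xi> UNIV"
    and v: "v \<in> measurable (sample_history M P \<xi> k) N"
  shows "random_variable N v"
proof -
  have "random_variable (\<Pi>\<^sub>M i\<in>{..<k}. P) (\<lambda>\<omega>. \<lambda>i\<in>{..<k}. \<xi> i \<omega>)"
    using indep by (intro measurable_restrict) (simp add: indep_vars_def)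
  then have "sets (sample_history M P \<xi> k) \<subseteq> events"
    unfolding sample_history_def by (rule sets_image_in_sets[OF refl])
  then show ?thesis
    using measurable_space[OF v] measurable_sets[OF v]
    by (intro measurableI) (auto simp: sample_history_def)
qed

text \<open>
  Independence of \<open>v\<close> and \<open>\<xi> k\<close>, stated through the joint distribution. The predicate \<open>indep_var\<close>
  relates random variables with values in one common type, so the sample enters as the family
  \<open>\<lambda>i\<in>{k}. \<xi> i\<close>, which has the same type as the history \<open>\<lambda>i\<in>{..<k}. \<xi> i\<close>.
\<close>
lemma (in prob_space) distr_past_and_next_sample:
  assumes indep: "indep_vars (\<lambda>_. P) \<xi> UNIV"
    and distr: "distr M P (\<xi> k) = P"
    and v: "v \<in> measurable (sample_history M P \<xi> k) N"
  shows "distr M N v \<Otimes>\<^sub>M P = distr M (N \<Otimes>\<^sub>M P) (\<lambda>\<omega>. (v \<omega>, \<xi> k \<omega>))"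
proof -
  define hist where "hist = (\<lambda>\<omega>. \<lambda>i\<in>{..<k}. \<xi> i \<omega>)"
  define Q where "Q = (\<Pi>\<^sub>M i\<in>{..<k}. P)"
  have [measurable]: "random_variable P (\<xi> k)"
    using indep by (auto simp: indep_vars_def)
  have [measurable]: "random_variable N v"
    by (rule measurable_sample_history_imp[OF indep v])
  have "indep_var Q hist (\<Pi>\<^sub>M i\<in>{k}. P) (\<lambda>\<omega>. \<lambda>i\<in>{k}. \<xi> i \<omega>)"
    unfolding Q_def hist_def by (rule indep_var_restrict[OF indep]) auto
  then have ind: "indep_set (sigma_sets (space M) {hist -` A \<inter> space M |A. A \<in> sets Q})
     (sigma_sets (space M) {(\<lambda>\<omega>. \<lambda>i\<in>{k}. \<xi> i \<omega>) -` A \<inter> space M |A. A \<in> sets (\<Pi>\<^sub>M i\<in>{k}. P)})"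
    by (auto simp: indep_var_eq)
  have prod: "prob ((v -` A \<inter> space M) \<inter> (\<xi> k -` B \<inter> space M))
      = prob (v -` A \<inter> space M) * prob (\<xi> k -` B \<inter> space M)"
    if A: "A \<in> sets N" and B: "B \<in> sets P" for A B
  proof (rule indep_setD[OF ind])
    show "v -` A \<inter> space M \<in> sigma_sets (space M) {hist -` A \<inter> space M |A. A \<in> sets Q}"
      using measurable_sets[OF v A]
      by (simp add: sample_history_def sets_vimage_algebra hist_def Q_def)
    have "\<xi> k -` B \<inter> space M = (\<lambda>\<omega>. \<lambda>i\<in>{k}. \<xi> i \<omega>) -` (\<Pi>\<^sub>E i\<in>{k}. B) \<inter> space M"
      by (auto simp: PiE_iff)
    moreover have "(\<Pi>\<^sub>E i\<in>{k}. B) \<in> sets (\<Pi>\<^sub>M i\<in>{k}. P)"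
      using B by (intro sets_PiM_I_finite) auto
    ultimately show "\<xi> k -` B \<inter> space M \<in> sigma_sets (space M)
        {(\<lambda>\<omega>. \<lambda>i\<in>{k}. \<xi> i \<omega>) -` A \<inter> space M |A. A \<in> sets (\<Pi>\<^sub>M i\<in>{k}. P)}"
      by (intro sigma_sets.Basic) blast
  qed
  interpret V: prob_space "distr M N v" by (rule prob_space_distr) simp
  interpret P: prob_space P
    by (subst distr[symmetric], rule prob_space_distr) simp
  show ?thesis
  proof (rule pair_measure_eqI)
    fix A B assume "A \<in> sets (distr M N v)" and B: "B \<in> sets P"
    then have A: "A \<in> sets N" by simp
    have "emeasure (distr M N v) A * emeasure (distr M P (\<xi> k)) B
        = ennreal (prob (v -` A \<inter> space M) * prob (\<xi> k -` B \<inter> space M))"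
      using A B by (simp add: emeasure_distr emeasure_eq_measure ennreal_mult)
    also have "\<dots> = emeasure M ((v -` A \<inter> space M) \<inter> (\<xi> k -` B \<inter> space M))"
      by (simp only: prod[OF A B] emeasure_eq_measure)
    also have "(v -` A \<inter> space M) \<inter> (\<xi> k -` B \<inter> space M) = (\<lambda>\<omega>. (v \<omega>, \<xi> k \<omega>)) -` (A \<times> B) \<inter> space M"
      by auto
    finally show "emeasure (distr M N v) A * emeasure P B
        = emeasure (distr M (N \<Otimes>\<^sub>M P) (\<lambda>\<omega>. (v \<omega>, \<xi> k \<omega>))) (A \<times> B)"
      using A B by (simp add: emeasure_distr distr)
  qed (auto simp: V.sigma_finite_measure_axioms P.sigma_finite_measure_axioms cong: sets_pair_measure_cong)
qed

text \<open>
  The substitute for conditioning on the past: a fresh sample may be integrated out first, with the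
  past held fixed.
\<close>
lemma (in prob_space) nn_integral_past_and_next_sample:
  assumes "indep_vars (\<lambda>_. P) \<xi> UNIV" and "distr M P (\<xi> k) = P"
    and "v \<in> measurable (sample_history M P \<xi> k) N"
    and P: "prob_space P" and F[measurable]: "F \<in> borel_measurable (N \<Otimes>\<^sub>M P)"
  shows "(\<integral>\<^sup>+ \<omega>. F (v \<omega>, \<xi> k \<omega>) \<partial>M) = (\<integral>\<^sup>+ \<omega>. \<integral>\<^sup>+ \<zeta>. F (v \<omega>, \<zeta>) \<partial>P \<partial>M)"
proof -
  interpret P: prob_space P by fact
  have [measurable]: "random_variable N v" "random_variable P (\<xi> k)"
    using measurable_sample_history_imp[OF assms(1,3)] assms(1) by (auto simp: indep_vars_def)
  have "(\<integral>\<^sup>+ \<omega>. F (v \<omega>, \<xi> k \<omega>) \<partial>M) = (\<integral>\<^sup>+ z. F z \<partial>distr M (N \<Otimes>\<^sub>M P) (\<lambda>\<omega>. (v \<omega>, \<xi> k \<omega>)))"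
    by (simp add: nn_integral_distr)
  also have "\<dots> = (\<integral>\<^sup>+ z. F z \<partial>(distr M N v \<Otimes>\<^sub>M P))"
    by (simp add: distr_past_and_next_sample[OF assms(1-3)])
  also have "\<dots> = (\<integral>\<^sup>+ y. \<integral>\<^sup>+ \<zeta>. F (y, \<zeta>) \<partial>P \<partial>distr M N v)"
    by (rule P.nn_integral_fst[symmetric]) (simp cong: measurable_cong_sets)
  also have "\<dots> = (\<integral>\<^sup>+ \<omega>. \<integral>\<^sup>+ \<zeta>. F (v \<omega>, \<zeta>) \<partial>P \<partial>M)"
    by (simp add: nn_integral_distr)
  finally show ?thesis .
qed

section \<open>Solving the recursion\<close>

lemma S_bar_closed_form: "S_bar k = real k * (real k + 1) * (2 * real k + 1) / 6"
  by (induction k) (simp_all add: S_bar_def field_simps power2_eq_square)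

text \<open>
  Multiplied by \<open>(k + 1)\<^sup>2\<close>, the recursion telescopes, since \<open>(k + 1)\<^sup>2 (1 - 2 / (k + 1)) = k\<^sup>2 - 1\<close>. With
  \<open>K = 4 C / \<mu>\<^sup>2\<close> this gives \<open>k\<^sup>2 a\<^sub>k + q / 4 \<Sum>\<^sub>t (t + 1)\<^sup>2 D\<^sub>t \<le> K k\<close>. The sum of the \<open>D\<^sub>t\<close> is bounded
  directly; for the \<open>a\<^sub>t\<close> one uses \<open>a\<^sub>t \<le> K / t\<close>. Division by \<open>S_bar k\<close>, which is of order \<open>k\<^sup>3\<close>,
  yields the two rates.
\<close>
lemma weighted_recursion_bounds:
  fixes a D :: "nat \<Rightarrow> real"
  assumes pos: "\<mu> > 0" "q > 0" "C \<ge> 0" and nonneg: "\<And>k. a k \<ge> 0" "\<And>k. D k \<ge> 0"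
    and step: "\<And>k. a (Suc k) + q / 4 * D k \<le> (1 - 2 / (real k + 1)) * a k + 4 * C / (\<mu>\<^sup>2 * (real k + 1)\<^sup>2)"
    and k: "k \<ge> 1"
  shows "1 / S_bar k * (\<Sum>t<k. (real t + 1)\<^sup>2 * a t) \<le> 100 * (C / (\<mu>\<^sup>2 * (real k + 1)))"
    and "1 / S_bar k * (\<Sum>t<k. (real t + 1)\<^sup>2 * D t) \<le> 100 * (2 * C / (q * \<mu>\<^sup>2 * (real k + 1)\<^sup>2))"
proof -
  define K where "K = 4 * C / \<mu>\<^sup>2"
  have K: "K \<ge> 0" using pos by (simp add: K_def)
  have scaled: "(real j + 1)\<^sup>2 * a (Suc j) + q / 4 * ((real j + 1)\<^sup>2 * D j) \<le> ((real j)\<^sup>2 - 1) * a j + K" for j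
  proof -
    define m where "m = real j + 1"
    have m: "m > 0" "real j = m - 1" by (simp_all add: m_def)
    have "a (Suc j) + q / 4 * D j \<le> (1 - 2 / m) * a j + K / m\<^sup>2"
      using step[of j] by (simp add: m_def K_def)
    then have "m\<^sup>2 * (a (Suc j) + q / 4 * D j) \<le> m\<^sup>2 * ((1 - 2 / m) * a j + K / m\<^sup>2)"
      by (intro mult_left_mono) auto
    also have "\<dots> = ((m - 1)\<^sup>2 - 1) * a j + K"
      using m by (simp add: field_simps power2_eq_square)
    finally show ?thesis
      by (simp add: m(2) algebra_simps)
  qed
  have sum: "(real j)\<^sup>2 * a j + q / 4 * (\<Sum>t<j. (real t + 1)\<^sup>2 * D t) \<le> K * real j" for j
  proof (induction j)
    case (Suc j)
    have "(real j + 1)\<^sup>2 * a (Suc j) + q / 4 * (\<Sum>t<Suc j. (real t + 1)\<^sup>2 * D t)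
        \<le> ((real j)\<^sup>2 * a j + q / 4 * (\<Sum>t<j. (real t + 1)\<^sup>2 * D t)) + K - a j"
      using scaled[of j] by (simp add: algebra_simps)
    then show ?case
      using Suc nonneg(1)[of j] by (simp add: algebra_simps)
  qed simp
  have S: "S_bar k > 0" using k by (simp add: S_bar_closed_form)
  have each: "(real t + 1)\<^sup>2 * a t \<le> 4 * K * (real t + 1)" for t
  proof (cases "t = 0")
    case True
    \<comment> \<open>at \<open>k = 0\<close> the factor \<open>1 - 2 / (k + 1)\<close> is \<open>-1\<close>, which bounds the initial error itself\<close>
    have "a 0 \<le> K"
    proof -
      have "q / 4 * D 0 \<ge> 0" using pos nonneg(2)[of 0] by simp
      then show ?thesis using scaled[of 0] nonneg(1)[of 1] by simp
    qed
    then show ?thesis using True K by simp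
  next
    case False
    then have t: "real t \<ge> 1" by simp
    have "(\<Sum>i<t. (real i + 1)\<^sup>2 * D i) \<ge> 0"
      using nonneg by (intro sum_nonneg) simp
    then have "q / 4 * (\<Sum>i<t. (real i + 1)\<^sup>2 * D i) \<ge> 0"
      using pos(2) by simp
    then have ta: "(real t)\<^sup>2 * a t \<le> K * real t"
      using sum[of t] by linarith
    \<comment> \<open>\<open>t + 1 \<le> 2 t\<close> turns the weight \<open>(t + 1)\<^sup>2\<close> into the \<open>t\<^sup>2\<close> of the previous bound\<close>
    have "(real t + 1)\<^sup>2 \<le> (2 * real t)\<^sup>2"
      using t by (intro power_mono) auto
    then have "(real t + 1)\<^sup>2 * a t \<le> (2 * real t)\<^sup>2 * a t"
      using nonneg by (intro mult_right_mono) auto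
    also have "\<dots> = 4 * ((real t)\<^sup>2 * a t)" by (simp add: power2_eq_square)
    also have "\<dots> \<le> 4 * K * (real t + 1)" using ta K by (simp add: algebra_simps)
    finally show ?thesis .
  qed
  have "(\<Sum>t<k. (real t + 1)\<^sup>2 * a t) \<le> (\<Sum>t<k. 4 * K * (real t + 1))"
    by (intro sum_mono each)
  also have "\<dots> = 2 * K * (real k * (real k + 1))"
    by (induction k) (simp_all add: algebra_simps)
  finally have "1 / S_bar k * (\<Sum>t<k. (real t + 1)\<^sup>2 * a t) \<le> 1 / S_bar k * (2 * K * (real k * (real k + 1)))"
    using S by (intro mult_left_mono) auto
  also have "\<dots> = 12 * K / (2 * real k + 1)"
  proof -
    have "1 / (i * j * m / 6) * (2 * K * (i * j)) = 12 * K / m" if "i > 0" "j > 0" "m > 0" for i j m :: real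
      using that by (simp add: field_simps)
    then show ?thesis using k by (simp add: S_bar_closed_form)
  qed
  also have "\<dots> \<le> 25 * K / (real k + 1)"
    using K by (intro frac_le) auto
  finally show "1 / S_bar k * (\<Sum>t<k. (real t + 1)\<^sup>2 * a t) \<le> 100 * (C / (\<mu>\<^sup>2 * (real k + 1)))"
    by (simp add: K_def)
  have "q / 4 * (\<Sum>t<k. (real t + 1)\<^sup>2 * D t) \<le> K * real k"
    using sum[of k] mult_nonneg_nonneg[OF zero_le_power2 nonneg(1), of "real k" k] by linarith
  then have "(\<Sum>t<k. (real t + 1)\<^sup>2 * D t) \<le> 4 * K / q * real k"
    using pos(2) by (simp add: field_simps)
  then have "1 / S_bar k * (\<Sum>t<k. (real t + 1)\<^sup>2 * D t) \<le> 1 / S_bar k * (4 * K / q * real k)"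
    using S by (intro mult_left_mono) auto
  also have "\<dots> = 24 * (K / q) / ((real k + 1) * (2 * real k + 1))"
  proof -
    have "1 / (i * j * m / 6) * (4 * K / q * i) = 24 * (K / q) / (j * m)" if "i > 0" "j > 0" "m > 0" for i j m :: real
      using that pos(2) by (simp add: field_simps)
    then show ?thesis using k by (simp add: S_bar_closed_form)
  qed
  also have "\<dots> \<le> 50 * (K / q) / ((real k + 1) * (real k + 1))"
    using K pos(2) by (intro frac_le mult_right_mono mult_left_mono) auto
  finally show "1 / S_bar k * (\<Sum>t<k. (real t + 1)\<^sup>2 * D t) \<le> 100 * (2 * C / (q * \<mu>\<^sup>2 * (real k + 1)\<^sup>2))"
    using pos by (simp add: K_def power2_eq_square mult_ac)
qed

section \<open>Convergence rates\<close>

theorem theorem11: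
  fixes Y X :: "(real ^ 'n) set"
    and f :: "real ^ 'n \<Rightarrow> real"
    and gf :: "real ^ 'n \<Rightarrow> real ^ 'n"
    and h :: "real ^ 'n \<Rightarrow> 'w \<Rightarrow> real"
    and gh :: "real ^ 'n \<Rightarrow> 'w \<Rightarrow> real ^ 'n"
    and L :: "'w \<Rightarrow> real"
    and P :: "'w measure"
    and M :: "'m measure"
    and \<xi> :: "nat \<Rightarrow> 'm \<Rightarrow> 'w"
    and x v :: "nat \<Rightarrow> 'm \<Rightarrow> real ^ 'n"
    and x\<^sub>0 xstar :: "real ^ 'n"
    and \<alpha> :: "nat \<Rightarrow> real"
    and \<mu> \<beta> c Bbar\<^sub>f B\<^sub>f B\<^sub>h M\<^sub>h Bsq C :: real
  \<comment> \<open>the problem; the index set is the space of \<open>P\<close>\<close>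
  assumes Y: "Y \<noteq> {}" "closed Y" "convex Y"
    and f_convex: "convex_on UNIV f"
    and gf: "\<And>y. gf y \<in> subdifferential f y"
    and P: "prob_space P"
    and h_measurable: "\<And>y. h y \<in> borel_measurable P"
    and h_gradient: "\<And>y \<zeta>. \<zeta> \<in> space P \<Longrightarrow> GDERIV (\<lambda>u. h u \<zeta>) y :> gh y \<zeta>"
    and h_C1: "\<And>\<zeta>. \<zeta> \<in> space P \<Longrightarrow> continuous_on UNIV (\<lambda>u. gh u \<zeta>)"
    and X: "X = feasible_set Y h (space P)"
    and xstar: "is_arg_min f (\<lambda>y. y \<in> X) xstar"
  \<comment> \<open>the algorithm\<close>
    and \<mu>: "\<mu> > 0"
    and \<beta>: "0 < \<beta>" "\<beta> < 1"
    and \<alpha>: "\<And>k. \<alpha> k = 2 / (\<mu> * (real k + 1))"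
    and M: "prob_space M"
    and \<xi>_indep: "prob_space.indep_vars M (\<lambda>_. P) \<xi> UNIV"
    and \<xi>_distr: "\<And>k. distr M P (\<xi> k) = P"
    and x_0: "x\<^sub>0 \<in> Y" "\<And>\<omega>. \<omega> \<in> space M \<Longrightarrow> x 0 \<omega> = x\<^sub>0"
    and v_k: "\<And>k \<omega>. \<omega> \<in> space M \<Longrightarrow>
          v k \<omega> = closest_point Y (x k \<omega> - \<alpha> k *\<^sub>R gf (x k \<omega>))"
    and x_Suc: "\<And>k \<omega>. \<omega> \<in> space M \<Longrightarrow>
          x (Suc k) \<omega> = closest_point Y (smba_z h gh L \<beta> (v k \<omega>) (\<xi> k \<omega>))"
    and x_measurable: "\<And>k. x k \<in> borel_measurable (sample_history M P \<xi> k)"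
    and v_measurable: "\<And>k. v k \<in> borel_measurable (sample_history M P \<xi> k)"
  \<comment> \<open>(a)\<close>
    and strongly_convex: "\<And>y z. y \<in> Y \<Longrightarrow> z \<in> Y \<Longrightarrow>
          f z \<ge> f y + gf y \<bullet> (z - y) + \<mu> / 2 * (norm (z - y))\<^sup>2"
  \<comment> \<open>(b)\<close>
    and h_convex: "\<And>\<zeta>. \<zeta> \<in> space P \<Longrightarrow> convex_on UNIV (\<lambda>u. h u \<zeta>)"
    and L_pos: "\<And>\<zeta>. \<zeta> \<in> space P \<Longrightarrow> L \<zeta> > 0"
    and h_smooth: "\<And>\<zeta> y z. \<zeta> \<in> space P \<Longrightarrow> y \<in> Y \<Longrightarrow> z \<in> Y \<Longrightarrow>
          norm (gh y \<zeta> - gh z \<zeta>) \<le> L \<zeta> * norm (y - z)"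
    and L_bounded: "bdd_above (L ` space P)"
  \<comment> \<open>(c)\<close>
    and c_pos: "c > 0"
    and regularity: "\<And>y. y \<in> Y \<Longrightarrow>
          ennreal ((infdist y X)\<^sup>2) \<le> ennreal c * (\<integral>\<^sup>+ \<zeta>. ennreal ((max (h y \<zeta>) 0)\<^sup>2) \<partial>P)"
  \<comment> \<open>(d)\<close>
    and bounds_pos: "Bbar\<^sub>f > 0" "B\<^sub>f > 0" "B\<^sub>h > 0" "M\<^sub>h > 0"
    and bound_gf_proj: "\<And>k. AE \<omega> in M. norm (gf (closest_point X (x k \<omega>))) \<le> Bbar\<^sub>f"
    and bound_gf: "\<And>k. AE \<omega> in M. norm (gf (x k \<omega>)) \<le> B\<^sub>f"
    and bound_gh: "\<And>k. AE \<omega> in M. \<forall>\<zeta>\<in>space P. norm (gh (v k \<omega>) \<zeta>) \<le> B\<^sub>h"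
    and bound_h: "\<And>k. AE \<omega> in M. \<forall>\<zeta>\<in>space P. \<bar>h (v k \<omega>) \<zeta>\<bar> \<le> M\<^sub>h"
    and Bsq: "Bsq = calB_sq (space P) L B\<^sub>h M\<^sub>h"
    and C: "C = C_hat c Bsq \<beta> Bbar\<^sub>f B\<^sub>f"
  \<comment> \<open>100 is the absolute constant hidden in the order symbol; as a numeral it depends neither on
     the dimension nor on the spaces involved\<close>
  shows "\<forall>k\<ge>1.
      (\<integral>\<^sup>+ \<omega>. ennreal ((norm (x_hat x k \<omega> - xstar))\<^sup>2) \<partial>M)
        \<le> ennreal (100 * (C / (\<mu>\<^sup>2 * (real k + 1))
             + c * Bsq * C / (\<beta> * (1 - \<beta>) * \<mu>\<^sup>2 * (real k + 1)\<^sup>2))) \<and>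
      (\<integral>\<^sup>+ \<omega>. ennreal ((infdist (x_hat x k \<omega>) X)\<^sup>2) \<partial>M)
        \<le> ennreal (100 * (c * Bsq * C / (\<beta> * (1 - \<beta>) * \<mu>\<^sup>2 * (real k + 1)\<^sup>2)))"
proof -
  interpret M: prob_space M by fact
  interpret P: prob_space P by fact
  \<comment> \<open>expected relative gain of the feasibility step: \<open>smba_z_decrease\<close> gains
     \<open>2 \<beta> (1 - \<beta>) / Bsq\<close> times the squared violation, and by regularity the expected squared
     violation is at least \<open>1 / c\<close> times the squared distance; the constant \<open>C\<close> is exactly the
     one that \<open>combined_step_decrease\<close> produces for this \<open>q\<close>\<close>
  define q where "q = 2 * \<beta> * (1 - \<beta>) / (c * Bsq)"
  define dX where "dX y = infdist y X" for y
  define H where "H k \<omega> = max (h (v k \<omega>) (\<xi> k \<omega>)) 0" for k \<omega>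
  have \<xi>_rv[measurable]: "M.random_variable P (\<xi> k)" for k
    using \<xi>_indep by (auto simp: M.indep_vars_def)
  have \<xi>_in: "\<xi> k \<omega> \<in> space P" if "\<omega> \<in> space M" for k \<omega>
    by (rule measurable_space[OF \<xi>_rv that])

  have h_cont: "continuous_on UNIV (\<lambda>u. h u \<zeta>)" if "\<zeta> \<in> space P" for \<zeta>
    using h_gradient[OF that] unfolding gderiv_def
    by (intro continuous_at_imp_continuous_on ballI has_derivative_continuous)
  have X_closed: "closed X" and X_convex: "convex X"
    using feasible_set_closed_convex[OF Y(2,3) h_convex h_cont] by (simp_all add: X)
  have xstar_X: "xstar \<in> X" using xstar by (simp add: is_arg_min_def)
  then have X_ne: "X \<noteq> {}" by auto
  have X_sub: "y \<in> Y" "\<zeta> \<in> space P \<Longrightarrow> h y \<zeta> \<le> 0" if "y \<in> X" for y \<zeta>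
    using that by (auto simp: X feasible_set_def)

  have Bsq_ge: "B\<^sub>h\<^sup>2 \<le> Bsq" "\<zeta> \<in> space P \<Longrightarrow> M\<^sub>h * L \<zeta> \<le> Bsq" for \<zeta>
  proof -
    show "B\<^sub>h\<^sup>2 \<le> Bsq" by (simp add: Bsq calB_sq_def)
    assume "\<zeta> \<in> space P"
    then have "M\<^sub>h * L \<zeta> \<le> M\<^sub>h * (SUP \<zeta>\<in>space P. L \<zeta>)"
      using bounds_pos(4) by (intro mult_left_mono cSUP_upper L_bounded) auto
    then show "M\<^sub>h * L \<zeta> \<le> Bsq" by (simp add: Bsq calB_sq_def)
  qed
  have "B\<^sub>h\<^sup>2 > 0" using bounds_pos(3) by simp
  then have Bsq_pos: "Bsq > 0" using Bsq_ge(1) by linarith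
  have q_pos: "q > 0" using \<beta> c_pos Bsq_pos by (simp add: q_def)
  have qc: "q * c = 2 * \<beta> * (1 - \<beta>) / Bsq" using c_pos by (simp add: q_def)
  have C_q: "C = 4 / q * Bbar\<^sub>f\<^sup>2 + (1 + q) * B\<^sub>f\<^sup>2"
    by (simp add: C C_hat_def q_def)
  have C_nonneg: "C \<ge> 0" using q_pos by (simp add: C_q)
  have \<alpha>_pos: "\<alpha> k > 0" for k using \<mu> by (simp add: \<alpha>)

  have v_Y: "v k \<omega> \<in> Y" if "\<omega> \<in> space M" for k \<omega>
    using closest_point_in_set[OF Y(2,1)] by (simp add: v_k[OF that])
  have x_Y: "x k \<omega> \<in> Y" if "\<omega> \<in> space M" for k \<omega>
    using closest_point_in_set[OF Y(2,1)] x_0 by (cases k) (simp_all add: x_Suc that)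

  \<comment> \<open>countably many almost sure bounds, so almost every outcome satisfies all of them at once\<close>
  define good where "good \<omega> \<longleftrightarrow> \<omega> \<in> space M \<and> (\<forall>k. norm (gf (closest_point X (x k \<omega>))) \<le> Bbar\<^sub>f
      \<and> norm (gf (x k \<omega>)) \<le> B\<^sub>f \<and> (\<forall>\<zeta>\<in>space P. norm (gh (v k \<omega>) \<zeta>) \<le> B\<^sub>h)
      \<and> (\<forall>\<zeta>\<in>space P. \<bar>h (v k \<omega>) \<zeta>\<bar> \<le> M\<^sub>h))" for \<omega>
  have good: "AE \<omega> in M. good \<omega>"
    unfolding good_def AE_conj_iff AE_all_countable
    using bound_gf_proj bound_gf bound_gh bound_h by simp

  have feas: "(norm (x (Suc k) \<omega> - y))\<^sup>2 + q * c * (H k \<omega>)\<^sup>2 \<le> (norm (v k \<omega> - y))\<^sup>2"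
    if "good \<omega>" "y \<in> X" for k \<omega> y
  proof -
    define \<zeta> where "\<zeta> = \<xi> k \<omega>"
    have \<omega>: "\<omega> \<in> space M" and gh: "norm (gh (v k \<omega>) \<zeta>) \<le> B\<^sub>h" and hM: "\<bar>h (v k \<omega>) \<zeta>\<bar> \<le> M\<^sub>h"
      using that(1) \<xi>_in by (auto simp: good_def \<zeta>_def)
    have \<zeta>: "\<zeta> \<in> space P" using \<xi>_in[OF \<omega>] by (simp add: \<zeta>_def)
    have "h (v k \<omega>) \<zeta> + gh (v k \<omega>) \<zeta> \<bullet> (y - v k \<omega>) \<le> 0"
      using convex_above_gradient_tangent[OF h_convex[OF \<zeta>] h_gradient[OF \<zeta>]] X_sub(2)[OF that(2) \<zeta>]
      by (rule order_trans)
    moreover have "(norm (gh (v k \<omega>) \<zeta>))\<^sup>2 \<le> Bsq"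
      using power_mono[OF gh, of 2] Bsq_ge(1) by simp
    moreover have "h (v k \<omega>) \<zeta> * L \<zeta> \<le> Bsq"
    proof -
      have "h (v k \<omega>) \<zeta> * L \<zeta> \<le> M\<^sub>h * L \<zeta>"
        using hM L_pos[OF \<zeta>] by (intro mult_right_mono) auto
      then show ?thesis using Bsq_ge(2)[OF \<zeta>] by linarith
    qed
    ultimately have "(norm (smba_z h gh L \<beta> (v k \<omega>) \<zeta> - y))\<^sup>2 + q * c * (max (h (v k \<omega>) \<zeta>) 0)\<^sup>2
        \<le> (norm (v k \<omega> - y))\<^sup>2"
      unfolding qc using L_pos[OF \<zeta>] \<beta> Bsq_pos by (intro smba_z_decrease)
    moreover have "(norm (x (Suc k) \<omega> - y))\<^sup>2 \<le> (norm (smba_z h gh L \<beta> (v k \<omega>) \<zeta> - y))\<^sup>2"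
      unfolding x_Suc[OF \<omega>] \<zeta>_def
      by (intro power_mono norm_closest_point_diff_le Y X_sub(1) that(2) norm_ge_zero)
    ultimately show ?thesis unfolding H_def \<zeta>_def by linarith
  qed

  have v_near: "norm (v k \<omega> - y) \<le> norm (x k \<omega> - y) + \<alpha> k * B\<^sub>f"
    if "good \<omega>" "y \<in> Y" for k \<omega> y
  proof -
    have \<omega>: "\<omega> \<in> space M" and g: "norm (gf (x k \<omega>)) \<le> B\<^sub>f"
      using that by (auto simp: good_def)
    have "norm (v k \<omega> - y) \<le> norm ((x k \<omega> - y) - \<alpha> k *\<^sub>R gf (x k \<omega>))"
      using norm_closest_point_diff_le[OF Y(3,2) that(2), of "x k \<omega> - \<alpha> k *\<^sub>R gf (x k \<omega>)"]
      by (simp add: v_k[OF \<omega>] algebra_simps)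
    also have "\<dots> \<le> norm (x k \<omega> - y) + norm (\<alpha> k *\<^sub>R gf (x k \<omega>))"
      by (rule norm_triangle_ineq4)
    also have "\<dots> \<le> norm (x k \<omega> - y) + \<alpha> k * B\<^sub>f"
      using g \<alpha>_pos[of k] by simp
    finally show ?thesis .
  qed

  have decrease: "(norm (x (Suc k) \<omega> - xstar))\<^sup>2 + q * c * (H k \<omega>)\<^sup>2 + q / 4 * (dX (x k \<omega>))\<^sup>2
      \<le> (1 - \<alpha> k * \<mu>) * (norm (x k \<omega> - xstar))\<^sup>2 + q * (dX (v k \<omega>))\<^sup>2 + (\<alpha> k)\<^sup>2 * C"
    if "good \<omega>" for k \<omega>
    unfolding C_q
  proof (rule combined_step_decrease[OF q_pos less_imp_le[OF \<alpha>_pos] feas[OF that xstar_X]])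
    have \<omega>: "\<omega> \<in> space M" using that by (simp add: good_def)
    show "(norm (v k \<omega> - xstar))\<^sup>2 \<le> (1 - \<alpha> k * \<mu>) * (norm (x k \<omega> - xstar))\<^sup>2
        + 2 * \<alpha> k * (f xstar - f (x k \<omega>)) + (\<alpha> k)\<^sup>2 * B\<^sub>f\<^sup>2"
      unfolding v_k[OF \<omega>]
      using that less_imp_le[OF \<alpha>_pos]
      by (intro projected_subgradient_step Y X_sub(1)[OF xstar_X] strongly_convex x_Y \<omega>) (auto simp: good_def)
    show "f xstar - f (x k \<omega>) \<le> Bbar\<^sub>f * dX (x k \<omega>)"
      unfolding dX_def using that
      by (intro optimality_gap_le_infdist[OF X_closed xstar gf]) (auto simp: good_def)
    show "0 \<le> dX (x k \<omega>)" by (simp add: dX_def infdist_nonneg)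
    have "dX (x k \<omega>) \<le> dX (v k \<omega>) + dist (x k \<omega>) (v k \<omega>)"
      unfolding dX_def by (rule infdist_triangle)
    then show "dX (x k \<omega>) \<le> dX (v k \<omega>) + \<alpha> k * B\<^sub>f"
      using v_near[OF that x_Y[OF \<omega>], of k k] by (simp add: dist_norm norm_minus_commute)
  qed

  \<comment> \<open>each iterate is bounded on the good outcomes, so all expectations below are finite and
     inequalities between them may be rearranged\<close>
  have "\<exists>K. \<forall>\<omega>. good \<omega> \<longrightarrow> norm (x k \<omega> - xstar) \<le> K" for k
  proof (induction k)
    case 0
    then show ?case by (auto simp: good_def x_0)
  next
    case (Suc k)
    then obtain K where K: "\<And>\<omega>. good \<omega> \<Longrightarrow> norm (x k \<omega> - xstar) \<le> K" by blast
    have "norm (x (Suc k) \<omega> - xstar) \<le> K + \<alpha> k * B\<^sub>f" if "good \<omega>" for \<omega>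
    proof -
      have "0 \<le> q * c * (H k \<omega>)\<^sup>2" using q_pos c_pos by simp
      then have "(norm (x (Suc k) \<omega> - xstar))\<^sup>2 \<le> (norm (v k \<omega> - xstar))\<^sup>2"
        using feas[OF that xstar_X, of k] by linarith
      then have "norm (x (Suc k) \<omega> - xstar) \<le> norm (v k \<omega> - xstar)"
        by (rule power2_le_imp_le) simp
      then show ?thesis
        using v_near[OF that X_sub(1)[OF xstar_X], of k] K[OF that] by linarith
    qed
    then show ?case by blast
  qed
  then obtain K where K: "\<And>k \<omega>. good \<omega> \<Longrightarrow> norm (x k \<omega> - xstar) \<le> K k" by metis

  have [measurable]: "M.random_variable borel (x k)" "M.random_variable borel (v k)" for k
    using M.measurable_sample_history_imp[OF \<xi>_indep] x_measurable v_measurable by blast+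
  have h_joint[measurable]: "(\<lambda>(y, \<zeta>). h y \<zeta>) \<in> borel_measurable (borel \<Otimes>\<^sub>M P)"
    by (rule measurable_pair_continuous_in_fst[OF h_cont h_measurable])
  have [measurable]: "M.random_variable borel (H k)" for k
  proof -
    have "(\<lambda>\<omega>. case (v k \<omega>, \<xi> k \<omega>) of (y, \<zeta>) \<Rightarrow> h y \<zeta>) \<in> borel_measurable M"
      by (rule measurable_compose[OF _ h_joint]) measurable
    then show ?thesis unfolding H_def by simp
  qed
  have [measurable]: "dX \<in> borel_measurable borel"
    unfolding dX_def by (intro borel_measurable_continuous_onI continuous_intros)

  have int_x: "integrable M (\<lambda>\<omega>. (norm (x k \<omega> - xstar))\<^sup>2)" for k
  proof (rule M.integrable_const_bound)
    show "AE \<omega> in M. norm ((norm (x k \<omega> - xstar))\<^sup>2) \<le> (K k)\<^sup>2"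
      using good by eventually_elim (simp add: K power_mono)
  qed measurable
  have dX_le: "dX y \<le> norm (y - xstar)" for y
    using infdist_le[OF xstar_X] by (simp add: dX_def dist_norm)
  have dX_nonneg: "0 \<le> dX y" for y by (simp add: dX_def infdist_nonneg)
  have int_dx: "integrable M (\<lambda>\<omega>. (dX (x k \<omega>))\<^sup>2)" for k
    by (rule Bochner_Integration.integrable_bound[OF int_x[of k]])
      (auto intro!: power_mono dX_le dX_nonneg)
  have int_dv: "integrable M (\<lambda>\<omega>. (dX (v k \<omega>))\<^sup>2)" for k
  proof (rule M.integrable_const_bound)
    show "AE \<omega> in M. norm ((dX (v k \<omega>))\<^sup>2) \<le> (K k + \<alpha> k * B\<^sub>f)\<^sup>2"
      using good
    proof eventually_elim
      case (elim \<omega>)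
      then have "dX (v k \<omega>) \<le> K k + \<alpha> k * B\<^sub>f"
        using dX_le[of "v k \<omega>"] v_near[OF elim X_sub(1)[OF xstar_X], of k] K[OF elim, of k] by linarith
      then show ?case using dX_nonneg by (simp add: power_mono)
    qed
  qed measurable
  have int_H: "integrable M (\<lambda>\<omega>. (H k \<omega>)\<^sup>2)" for k
  proof (rule M.integrable_const_bound)
    show "AE \<omega> in M. norm ((H k \<omega>)\<^sup>2) \<le> M\<^sub>h\<^sup>2"
      using good
    proof eventually_elim
      case (elim \<omega>)
      then have "\<bar>h (v k \<omega>) (\<xi> k \<omega>)\<bar> \<le> M\<^sub>h" using \<xi>_in by (auto simp: good_def)
      then show ?case using bounds_pos(4) by (simp add: H_def power_mono)
    qed
  qed measurable

  \<comment> \<open>regularity is applied to \<open>v k \<omega>\<close> for a fixed outcome; independence replaces the average over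
     all constraints by the sampled one\<close>
  have dist_v: "(\<integral>\<omega>. (dX (v k \<omega>))\<^sup>2 \<partial>M) \<le> c * (\<integral>\<omega>. (H k \<omega>)\<^sup>2 \<partial>M)" for k
  proof -
    let ?F = "\<lambda>(y, \<zeta>). ennreal ((max (h y \<zeta>) 0)\<^sup>2)"
    have F: "?F \<in> borel_measurable (borel \<Otimes>\<^sub>M P)" by measurable
    have inner: "(\<lambda>\<omega>. \<integral>\<^sup>+ \<zeta>. ennreal ((max (h (v k \<omega>) \<zeta>) 0)\<^sup>2) \<partial>P) \<in> borel_measurable M"
      by measurable
    have "ennreal (\<integral>\<omega>. (dX (v k \<omega>))\<^sup>2 \<partial>M) = (\<integral>\<^sup>+ \<omega>. ennreal ((dX (v k \<omega>))\<^sup>2) \<partial>M)"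
      using int_dv by (simp add: nn_integral_eq_integral)
    also have "\<dots> \<le> (\<integral>\<^sup>+ \<omega>. ennreal c * (\<integral>\<^sup>+ \<zeta>. ennreal ((max (h (v k \<omega>) \<zeta>) 0)\<^sup>2) \<partial>P) \<partial>M)"
      unfolding dX_def by (intro nn_integral_mono regularity v_Y)
    also have "\<dots> = ennreal c * (\<integral>\<^sup>+ \<omega>. \<integral>\<^sup>+ \<zeta>. ?F (v k \<omega>, \<zeta>) \<partial>P \<partial>M)"
      using inner by (simp add: nn_integral_cmult)
    also have "\<dots> = ennreal c * (\<integral>\<^sup>+ \<omega>. ?F (v k \<omega>, \<xi> k \<omega>) \<partial>M)"
      by (simp only: M.nn_integral_past_and_next_sample[OF \<xi>_indep \<xi>_distr v_measurable P F])
    also have "\<dots> = ennreal c * ennreal (\<integral>\<omega>. (H k \<omega>)\<^sup>2 \<partial>M)"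
      using int_H[of k] by (simp add: H_def nn_integral_eq_integral)
    also have "\<dots> = ennreal (c * (\<integral>\<omega>. (H k \<omega>)\<^sup>2 \<partial>M))"
      using c_pos by (simp add: ennreal_mult)
    finally show ?thesis using c_pos by (simp add: ennreal_le_iff)
  qed

  define a where "a k = (\<integral>\<omega>. (norm (x k \<omega> - xstar))\<^sup>2 \<partial>M)" for k
  define D where "D k = (\<integral>\<omega>. (dX (x k \<omega>))\<^sup>2 \<partial>M)" for k
  have recursion: "a (Suc k) + q / 4 * D k \<le> (1 - 2 / (real k + 1)) * a k + 4 * C / (\<mu>\<^sup>2 * (real k + 1)\<^sup>2)" for k
  proof -
    have "(\<integral>\<omega>. (norm (x (Suc k) \<omega> - xstar))\<^sup>2 + q * c * (H k \<omega>)\<^sup>2 + q / 4 * (dX (x k \<omega>))\<^sup>2 \<partial>M)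
      \<le> (\<integral>\<omega>. (1 - \<alpha> k * \<mu>) * (norm (x k \<omega> - xstar))\<^sup>2 + q * (dX (v k \<omega>))\<^sup>2 + (\<alpha> k)\<^sup>2 * C \<partial>M)"
    proof (rule integral_mono_AE)
      show "AE \<omega> in M. (norm (x (Suc k) \<omega> - xstar))\<^sup>2 + q * c * (H k \<omega>)\<^sup>2 + q / 4 * (dX (x k \<omega>))\<^sup>2
          \<le> (1 - \<alpha> k * \<mu>) * (norm (x k \<omega> - xstar))\<^sup>2 + q * (dX (v k \<omega>))\<^sup>2 + (\<alpha> k)\<^sup>2 * C"
        using good by eventually_elim (rule decrease)
    qed (use int_x int_dx int_dv int_H in simp_all)
    then have "a (Suc k) + q * c * (\<integral>\<omega>. (H k \<omega>)\<^sup>2 \<partial>M) + q / 4 * D k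
      \<le> (1 - \<alpha> k * \<mu>) * a k + q * (\<integral>\<omega>. (dX (v k \<omega>))\<^sup>2 \<partial>M) + (\<alpha> k)\<^sup>2 * C"
      using int_x int_dx int_dv int_H by (simp add: a_def D_def M.prob_space)
    moreover have "q * (\<integral>\<omega>. (dX (v k \<omega>))\<^sup>2 \<partial>M) \<le> q * (c * (\<integral>\<omega>. (H k \<omega>)\<^sup>2 \<partial>M))"
      using dist_v q_pos by (intro mult_left_mono) auto
    ultimately have "a (Suc k) + q / 4 * D k \<le> (1 - \<alpha> k * \<mu>) * a k + (\<alpha> k)\<^sup>2 * C"
      by (simp add: mult.assoc)
    moreover have "\<alpha> k * \<mu> = 2 / (real k + 1)" "(\<alpha> k)\<^sup>2 * C = 4 * C / (\<mu>\<^sup>2 * (real k + 1)\<^sup>2)"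
      using \<mu> by (simp_all add: \<alpha> power_divide power_mult_distrib)
    ultimately show ?thesis by simp
  qed
  have nonneg: "a k \<ge> 0" "D k \<ge> 0" for k
    by (simp_all add: a_def D_def)

  have average: "(\<integral>\<^sup>+ \<omega>. ennreal (F (x_hat x k \<omega>)) \<partial>M) \<le> ennreal (1 / S_bar k * (\<Sum>t<k. (real t + 1)\<^sup>2 * (\<integral>\<omega>. F (x t \<omega>) \<partial>M)))"
    if k: "k \<ge> 1" and F: "\<And>y. F y \<ge> 0" "\<And>t. integrable M (\<lambda>\<omega>. F (x t \<omega>))"
      and avg: "\<And>\<omega>. F (x_hat x k \<omega>) \<le> 1 / S_bar k * (\<Sum>t<k. (real t + 1)\<^sup>2 * F (x t \<omega>))" for F k
  proof -
    have S: "S_bar k \<ge> 0" by (simp add: S_bar_closed_form)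
    have "(\<integral>\<^sup>+ \<omega>. ennreal (F (x_hat x k \<omega>)) \<partial>M)
        \<le> (\<integral>\<^sup>+ \<omega>. ennreal (1 / S_bar k * (\<Sum>t<k. (real t + 1)\<^sup>2 * F (x t \<omega>))) \<partial>M)"
      by (intro nn_integral_mono ennreal_leI avg)
    also have "\<dots> = ennreal (\<integral>\<omega>. 1 / S_bar k * (\<Sum>t<k. (real t + 1)\<^sup>2 * F (x t \<omega>)) \<partial>M)"
      using S F by (intro nn_integral_eq_integral AE_I2) (simp_all add: sum_nonneg)
    also have "(\<integral>\<omega>. 1 / S_bar k * (\<Sum>t<k. (real t + 1)\<^sup>2 * F (x t \<omega>)) \<partial>M)
        = 1 / S_bar k * (\<Sum>t<k. (real t + 1)\<^sup>2 * (\<integral>\<omega>. F (x t \<omega>) \<partial>M))"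
      using F(2) by (simp add: Bochner_Integration.integral_sum)
    finally show ?thesis .
  qed

  show ?thesis
  proof (intro allI impI conjI)
    fix k :: nat assume k: "1 \<le> k"
    note bounds = weighted_recursion_bounds[OF \<mu> q_pos C_nonneg nonneg recursion k]
    have S: "(\<Sum>t<k. (real t + 1)\<^sup>2) = S_bar k" "S_bar k > 0"
      using k by (simp_all only: S_bar_def[symmetric]) (simp add: S_bar_closed_form)
    have C_half: "2 * C / (q * \<mu>\<^sup>2 * (real k + 1)\<^sup>2) = c * Bsq * C / (\<beta> * (1 - \<beta>) * \<mu>\<^sup>2 * (real k + 1)\<^sup>2)"
      using \<beta> c_pos Bsq_pos \<mu> by (simp add: q_def) (simp add: mult_ac)

    have "(\<integral>\<^sup>+ \<omega>. ennreal ((norm (x_hat x k \<omega> - xstar))\<^sup>2) \<partial>M)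
        \<le> ennreal (1 / S_bar k * (\<Sum>t<k. (real t + 1)\<^sup>2 * a t))"
      unfolding a_def
    proof (rule average[OF k _ int_x])
      fix \<omega>
      have "x_hat x k \<omega> - xstar = (1 / S_bar k) *\<^sub>R (\<Sum>t<k. (real t + 1)\<^sup>2 *\<^sub>R (x t \<omega> - xstar))"
        using S by (simp add: x_hat_def scaleR_diff_right sum_subtractf scaleR_sum_left[symmetric])
      then show "(norm (x_hat x k \<omega> - xstar))\<^sup>2
          \<le> 1 / S_bar k * (\<Sum>t<k. (real t + 1)\<^sup>2 * (norm (x t \<omega> - xstar))\<^sup>2)"
        using norm_average_sq_le[of "{..<k}" "\<lambda>t. (real t + 1)\<^sup>2" "S_bar k" "\<lambda>t. x t \<omega> - xstar"] S by simp
    qed simp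
    also have "\<dots> \<le> ennreal (100 * (C / (\<mu>\<^sup>2 * (real k + 1))
             + c * Bsq * C / (\<beta> * (1 - \<beta>) * \<mu>\<^sup>2 * (real k + 1)\<^sup>2)))"
    proof (rule ennreal_leI)
      have "0 \<le> c * Bsq * C / (\<beta> * (1 - \<beta>) * \<mu>\<^sup>2 * (real k + 1)\<^sup>2)"
        using \<beta> c_pos Bsq_pos C_nonneg by simp
      then show "1 / S_bar k * (\<Sum>t<k. (real t + 1)\<^sup>2 * a t) \<le> 100 * (C / (\<mu>\<^sup>2 * (real k + 1))
             + c * Bsq * C / (\<beta> * (1 - \<beta>) * \<mu>\<^sup>2 * (real k + 1)\<^sup>2))"
        using bounds(1) by (simp only: distrib_left)
    qed
    finally show "(\<integral>\<^sup>+ \<omega>. ennreal ((norm (x_hat x k \<omega> - xstar))\<^sup>2) \<partial>M)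
        \<le> ennreal (100 * (C / (\<mu>\<^sup>2 * (real k + 1))
             + c * Bsq * C / (\<beta> * (1 - \<beta>) * \<mu>\<^sup>2 * (real k + 1)\<^sup>2)))" .

    have "(\<integral>\<^sup>+ \<omega>. ennreal ((infdist (x_hat x k \<omega>) X)\<^sup>2) \<partial>M)
        \<le> ennreal (1 / S_bar k * (\<Sum>t<k. (real t + 1)\<^sup>2 * D t))"
      unfolding D_def dX_def
    proof (rule average[OF k _ int_dx[unfolded dX_def]])
      show "(infdist (x_hat x k \<omega>) X)\<^sup>2 \<le> 1 / S_bar k * (\<Sum>t<k. (real t + 1)\<^sup>2 * (infdist (x t \<omega>) X)\<^sup>2)" for \<omega>
        unfolding x_hat_def by (rule infdist_average_sq_le[OF X_convex X_closed X_ne _ _ S]) simp_all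
    qed simp
    also have "\<dots> \<le> ennreal (100 * (c * Bsq * C / (\<beta> * (1 - \<beta>) * \<mu>\<^sup>2 * (real k + 1)\<^sup>2)))"
      using bounds(2) unfolding C_half by (rule ennreal_leI)
    finally show "(\<integral>\<^sup>+ \<omega>. ennreal ((infdist (x_hat x k \<omega>) X)\<^sup>2) \<partial>M)
        \<le> ennreal (100 * (c * Bsq * C / (\<beta> * (1 - \<beta>) * \<mu>\<^sup>2 * (real k + 1)\<^sup>2)))" .
  qed
qed

end
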